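(* Let $n\ge1$, let $F$ be a finite field with $q$ elements, and let $M_n(F)$ be the monoid of all $n\times n$ matrices over $F$ under multiplication. If $q=2$, then the minimal degree of a faithful action of $M_n(F)$ by partial mappings is $2^n-1$. Otherwise, writing $q-1=p_1^{m_1}\cdots p_k^{m_k}$ for the prime factorization with distinct primes $p_i$, the minimal degree of a faithful action of $M_n(F)$ by partial mappings is $\frac{q^n-1}{q-1}\cdot\sum_{i=1}^kp_i^{m_i}$.
   Context: The minimal degree of a faithful action by partial mappings of a semigroup $S$ is the least $m$ such that $S$ is isomorphic to a subsemigroup of the monoid $PT_m$ of all partial maps on an $m$-element set (acting on the right). *)

theory Defs
  imports "HOL-Analysis.Analysis" "HOL-Computational_Algebra.Primes"
begin

text \<open>Partial maps on the m-element set {0..<m}, represented as maps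
  nat \<rightharpoonup> nat with domain and range inside {0..<m}.\<close>
definition partial_maps_on :: "nat \<Rightarrow> (nat \<Rightarrow> nat option) set" where
  "partial_maps_on m = {f. dom f \<subseteq> {..<m} \<and> ran f \<subseteq> {..<m}}"

text \<open>A faithful right action of the semigroup (S, op) by partial maps on an
  m-element set: an injective homomorphism into PT_m, where maps act on the right,
  so the product s t acts as first s, then t.\<close>
definition faithful_pt_action :: "'s set \<Rightarrow> ('s \<Rightarrow> 's \<Rightarrow> 's) \<Rightarrow> nat \<Rightarrow> bool" where
  "faithful_pt_action S op m \<longleftrightarrow>
     (\<exists>\<phi>. inj_on \<phi> S \<and> (\<forall>s\<in>S. \<phi> s \<in> partial_maps_on m) \<and>
          (\<forall>s\<in>S. \<forall>t\<in>S. \<phi> (op s t) = (\<phi> t \<circ>\<^sub>m \<phi> s)))"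

definition min_pt_degree :: "'s set \<Rightarrow> ('s \<Rightarrow> 's \<Rightarrow> 's) \<Rightarrow> nat" where
  "min_pt_degree S op = (LEAST m. faithful_pt_action S op m)"

end

(*
  Let q = |F| and q - 1 = p_1^m_1 ... p_k^m_k. Both bounds equal the number (q^n - 1)/(q - 1) of
  lines of F^n times max 1 (p_1^m_1 + ... + p_k^m_k); the sum is empty when q = 2.

  Upper bound: a nonzero row vector is a line together with a scalar from the cyclic group F^*
  of order q - 1. Matrices act on the right on the disjoint union over i of lines x Z/p_i^m_i,
  the scalar being recorded by its discrete logarithm modulo p_i^m_i (for q = 2, on one copy of
  the lines). By the Chinese remainder theorem this action is faithful.

  Lower bound: for every line l take a rank-one idempotent E_l = u w with row space l. The points
  fixed by E_l but not by the zero matrix are permuted by the group {c E_l | c ~= 0}, cyclic of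
  order q - 1, and faithfully: a matrix B with E_l B = B that fixes all these points equals E_l.
  For B = 0 this also shows that there is such a point. A faithful action of the cyclic group of
  order N needs at least p_1^m_1 + ... + p_k^m_k points, since for each p_i some orbit has length
  divisible by p_i^m_i, and prime powers dividing the same orbit length sum to at most their
  product. The point sets of two different lines F w_1 and F w_2, with idempotents E_1 and E_2,
  are disjoint: if w_1 u = 0 and w_2 u = 1, then M = u w_2 satisfies E_1 M = 0 and E_2 M = E_2.
*)
theory Submission
  imports Defs "HOL-Algebra.Multiplicative_Group" "HOL-Number_Theory.Cong"
begin

section \<open>The multiplicative group of a finite field\<close>

definition type_ring :: "'a::field ring" where
  "type_ring = \<lparr>carrier = UNIV, monoid.mult = (*), one = 1, zero = 0, add = (+)\<rparr>"

lemma field_type_ring: "field (type_ring :: 'a::field ring)"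
proof -
  have "\<exists>y. x + y = 0" for x :: 'a
    using add.right_inverse by blast
  moreover have "x \<noteq> 0 \<Longrightarrow> \<exists>y. x * y = 1" for x :: 'a
    using right_inverse by blast
  ultimately show ?thesis
    unfolding type_ring_def by unfold_locales (auto simp: algebra_simps Units_def)
qed

lemma pow_type_ring: "x [^]\<^bsub>type_ring\<^esub> (n::nat) = (x::'a::field) ^ n"
  by (induction n) (simp_all add: type_ring_def power_Suc2)

lemma finite_field_generator:
  assumes "finite (UNIV :: 'a set)"
  obtains g :: "'a::field" where "g \<noteq> 0" and "\<And>x. x \<noteq> 0 \<Longrightarrow> \<exists>i. g ^ i = x"
    and "\<And>i j. g ^ i = g ^ j \<longleftrightarrow> [i = j] (mod CARD('a) - 1)"
proof -
  let ?R = "type_ring :: 'a ring"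
  let ?G = "mult_of ?R"
  interpret field ?R by (rule field_type_ring)
  interpret G: group ?G by (rule field_mult_group)
  have fin: "finite (carrier ?R)" using assms by (simp add: type_ring_def)
  obtain g where g: "g \<in> carrier ?G" and gen: "carrier ?G = {g [^]\<^bsub>?R\<^esub> i | i::nat. i \<in> UNIV}"
    using finite_field_mult_group_has_gen[OF fin] by (rule bexE)
  have "G.ord g = order ?G"
    using G.generate_pow_card[OF g] G.generate_pow_on_finite_carrier[OF finite_mult_of[OF fin] g] gen
    by (simp add: order_def nat_pow_mult_of)
  also have "\<dots> = CARD('a) - 1"
    using order_mult_of[OF fin] by (simp add: order_def type_ring_def)
  finally have ord: "G.ord g = CARD('a) - 1" .
  have pow: "g [^]\<^bsub>?G\<^esub> i = g ^ i" for i :: nat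
    by (simp add: nat_pow_mult_of pow_type_ring)
  show ?thesis
  proof
    show "g \<noteq> 0" using g by (simp add: type_ring_def)
    show "\<exists>i. g ^ i = x" if "x \<noteq> 0" for x
    proof -
      have "x \<in> carrier ?G" using that by (simp add: type_ring_def)
      then show ?thesis unfolding gen by (auto simp: pow_type_ring)
    qed
    show "g ^ i = g ^ j \<longleftrightarrow> [i = j] (mod CARD('a) - 1)" for i j
      using G.int_pow_eq[OF g, of "int i" "int j"]
      by (simp add: int_pow_int pow ord cong_iff_dvd_diff dvd_diff_commute flip: cong_int_iff)
  qed
qed

definition dlog :: "'a::field \<Rightarrow> 'a \<Rightarrow> nat" where
  "dlog g x = (LEAST i. g ^ i = x)"

lemma power_dlog: "\<exists>i. g ^ i = x \<Longrightarrow> g ^ dlog g x = x"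
  unfolding dlog_def by (rule LeastI_ex)

lemma two_le_card_field: "finite (UNIV :: 'a::field set) \<Longrightarrow> 2 \<le> CARD('a)"
  using card_mono[of UNIV "{0::'a, 1}"] by simp

section \<open>Prime power factors\<close>

definition prime_power_sum :: "nat \<Rightarrow> nat" where
  "prime_power_sum n = (\<Sum>p\<in>prime_factors n. p ^ multiplicity p n)"

lemma prime_power_factor_ge_2:
  fixes p n :: nat
  assumes "p \<in> prime_factors n" shows "2 \<le> p ^ multiplicity p n"
proof -
  have "prime p" "0 < multiplicity p n" using assms prime_factors_multiplicity[of n] by blast+
  then have "p \<le> p ^ multiplicity p n" using prime_gt_0_nat[of p] by (intro self_le_power) auto
  then show ?thesis using prime_ge_2_nat[OF \<open>prime p\<close>] by linarith
qed

lemma cong_prod_prime_power_factors: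
  fixes a b n :: nat
  assumes "P \<subseteq> prime_factors n" and "\<And>p. p \<in> P \<Longrightarrow> [a = b] (mod p ^ multiplicity p n)"
  shows "[a = b] (mod \<Prod>p\<in>P. p ^ multiplicity p n)"
proof (rule coprime_cong_prod_nat)
  show "coprime (p ^ multiplicity p n) (q ^ multiplicity q n)" if "p \<in> P" "q \<in> P" "p \<noteq> q" for p q
    using that assms(1) by (auto intro: primes_coprime simp: in_prime_factors_iff)
qed (use assms(2) in blast)

lemma cong_if_cong_prime_power_factors:
  fixes a b n :: nat
  assumes "0 < n" and "\<And>p. p \<in> prime_factors n \<Longrightarrow> [a = b] (mod p ^ multiplicity p n)"
  shows "[a = b] (mod n)"
  using cong_prod_prime_power_factors[OF order_refl assms(2)] prod_prime_factors[of n] assms(1)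
  by simp

lemma sum_le_prod_if_ge_2:
  fixes h :: "'b \<Rightarrow> nat"
  assumes "finite A" and "\<And>x. x \<in> A \<Longrightarrow> 2 \<le> h x"
  shows "sum h A \<le> prod h A"
proof -
  have "sum h A \<le> prod h A \<and> (A = {} \<or> 2 \<le> prod h A)"
    using assms
  proof (induction A rule: finite_induct)
    case (insert x A)
    have hx: "2 \<le> h x" using insert.prems by simp
    show ?case
    proof (cases "A = {}")
      case False
      with insert have IH: "sum h A \<le> prod h A" "2 \<le> prod h A" by auto
      have "2 * prod h A \<le> h x * prod h A" using hx by (rule mult_le_mono1)
      moreover have "h x * 2 \<le> h x * prod h A" using IH(2) by (rule mult_le_mono2)
      ultimately have "h x + sum h A \<le> h x * prod h A" using IH(1) by linarith
      moreover have "2 \<le> h x * prod h A" using \<open>2 * prod h A \<le> h x * prod h A\<close> IH(2) by linarith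
      ultimately show ?thesis using insert.hyps by simp
    qed (use hx in simp)
  qed simp
  then show ?thesis ..
qed

lemma sum_prime_power_factors_le:
  fixes n d :: nat
  assumes "P \<subseteq> prime_factors n" and "0 < d" and "\<And>p. p \<in> P \<Longrightarrow> p ^ multiplicity p n dvd d"
  shows "(\<Sum>p\<in>P. p ^ multiplicity p n) \<le> d"
proof -
  have fin: "finite P" using assms(1) finite_subset by blast
  have "(\<Sum>p\<in>P. p ^ multiplicity p n) \<le> (\<Prod>p\<in>P. p ^ multiplicity p n)"
    by (rule sum_le_prod_if_ge_2[OF fin]) (use assms(1) prime_power_factor_ge_2 in blast)
  also have "(\<Prod>p\<in>P. p ^ multiplicity p n) dvd d"
    using cong_prod_prime_power_factors[OF assms(1), of d 0] assms(3) by (simp add: cong_0_iff)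
  then have "(\<Prod>p\<in>P. p ^ multiplicity p n) \<le> d" using assms(2) by (rule dvd_imp_le)
  finally show ?thesis .
qed

lemma prime_power_factor_dvd_if_not_dvd_div:
  fixes d n p :: nat
  assumes "d dvd n" and p: "p \<in> prime_factors n" and "\<not> d dvd n div p"
  shows "p ^ multiplicity p n dvd d"
proof (rule ccontr)
  assume not_dvd: "\<not> p ^ multiplicity p n dvd d"
  obtain k where n: "n = d * k" using assms(1) by blast
  have prime: "prime p" and "n \<noteq> 0" using p by (auto simp: in_prime_factors_iff)
  then have "d \<noteq> 0" "k \<noteq> 0" using n by auto
  then have "multiplicity p n = multiplicity p d + multiplicity p k"
    using n prime by (simp add: prime_elem_multiplicity_mult_distrib)
  moreover have "multiplicity p d < multiplicity p n"
    using not_dvd multiplicity_dvd' not_le by blast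
  ultimately have "0 < multiplicity p k" by linarith
  then have "p dvd k" using \<open>k \<noteq> 0\<close> prime by (simp add: prime_multiplicity_gt_zero_iff)
  then obtain k' where "k = p * k'" ..
  then have "n div p = d * k'" using n prime by (simp add: mult.left_commute prime_gt_0_nat)
  then have "d dvd n div p" by simp
  with assms(3) show False ..
qed

lemma prime_power_sum_ge_2:
  assumes "1 < n" shows "2 \<le> prime_power_sum n"
proof -
  obtain p where "prime p" "p dvd n" using assms prime_factor_nat[of n] by auto
  then have p: "p \<in> prime_factors n" using assms by (auto simp: in_prime_factors_iff)
  then have "2 \<le> p ^ multiplicity p n" by (rule prime_power_factor_ge_2)
  also have "\<dots> \<le> prime_power_sum n"
    unfolding prime_power_sum_def using p by (intro member_le_sum) auto
  finally show ?thesis .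
qed

section \<open>Faithful actions of a cyclic group\<close>

locale faithful_cyclic_action =
  fixes Y :: "'b set" and act :: "nat \<Rightarrow> 'b \<Rightarrow> 'b" and n :: nat
  assumes order_pos: "0 < n"
    and act_closed: "y \<in> Y \<Longrightarrow> act k y \<in> Y"
    and act_add: "y \<in> Y \<Longrightarrow> act (i + j) y = act i (act j y)"
    and act_trivial_iff: "(\<forall>y\<in>Y. act k y = y) \<longleftrightarrow> n dvd k"
begin

lemma act_mult_order: "y \<in> Y \<Longrightarrow> act (n * k) y = y"
  using act_trivial_iff[of "n * k"] by auto

lemma act_0: "y \<in> Y \<Longrightarrow> act 0 y = y"
  using act_mult_order[of y 0] by simp

lemma act_commute:
  assumes "y \<in> Y" shows "act i (act j y) = act j (act i y)"
  using act_add[OF assms, of i j] act_add[OF assms, of j i] by (metis add.commute)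

lemma act_inverse:
  assumes "y \<in> Y" shows "act (n * k - k) (act k y) = y"
proof -
  have "act (n * k - k) (act k y) = act (n * k - k + k) y" by (rule act_add[OF assms, symmetric])
  also have "n * k - k + k = n * k" using order_pos by simp
  finally show ?thesis using act_mult_order[OF assms] by simp
qed

lemma act_inj:
  assumes "y \<in> Y" "z \<in> Y" "act k y = act k z" shows "y = z"
proof -
  have "y = act (n * k - k) (act k y)" using act_inverse[OF assms(1)] by simp
  also have "\<dots> = z" using assms(3) act_inverse[OF assms(2)] by simp
  finally show ?thesis .
qed

definition period :: "'b \<Rightarrow> nat" where
  "period y = (LEAST k. 0 < k \<and> act k y = y)"

lemma period_pos_fixes:
  assumes "y \<in> Y" shows "0 < period y \<and> act (period y) y = y"
proof -
  have "0 < n \<and> act n y = y" using order_pos act_mult_order[OF assms, of 1] by simp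
  then show ?thesis unfolding period_def by (rule LeastI)
qed

lemma act_period_mult:
  assumes "y \<in> Y" shows "act (period y * q) y = y"
proof (induction q)
  case (Suc q)
  have "act (period y * Suc q) y = act (period y) (act (period y * q) y)"
    using act_add[OF assms, of "period y" "period y * q"] by simp
  then show ?case using Suc period_pos_fixes[OF assms] by simp
qed (simp add: act_0 assms)

lemma act_mod_period:
  assumes "y \<in> Y" shows "act k y = act (k mod period y) y"
proof -
  have "act k y = act (k mod period y) (act (period y * (k div period y)) y)"
    using act_add[OF assms, of "k mod period y" "period y * (k div period y)"] by simp
  then show ?thesis by (simp add: act_period_mult assms)
qed

lemma act_eq_self_iff:
  assumes "y \<in> Y" shows "act k y = y \<longleftrightarrow> period y dvd k"
proof
  assume "act k y = y"
  then have "act (k mod period y) y = y" using act_mod_period[OF assms, of k] by simp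
  moreover have "k mod period y < period y" using period_pos_fixes[OF assms] by simp
  then have "\<not> (0 < k mod period y \<and> act (k mod period y) y = y)"
    unfolding period_def by (rule not_less_Least)
  ultimately show "period y dvd k" by auto
qed (auto simp: act_period_mult[OF assms])

definition orbit :: "'b \<Rightarrow> 'b set" where
  "orbit y = range (\<lambda>k. act k y)"

lemma self_in_orbit: "y \<in> Y \<Longrightarrow> y \<in> orbit y"
  unfolding orbit_def using act_0 by (metis rangeI)

lemma orbit_eq_image_period:
  assumes "y \<in> Y" shows "orbit y = (\<lambda>k. act k y) ` {..<period y}"
proof
  show "orbit y \<subseteq> (\<lambda>k. act k y) ` {..<period y}"
  proof
    fix x assume "x \<in> orbit y"
    then obtain k where "x = act k y" unfolding orbit_def by blast
    then have "x = act (k mod period y) y" using act_mod_period[OF assms, of k] by simp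
    moreover have "k mod period y < period y" using period_pos_fixes[OF assms] by simp
    ultimately show "x \<in> (\<lambda>k. act k y) ` {..<period y}" by blast
  qed
qed (auto simp: orbit_def)

lemma card_orbit:
  assumes "y \<in> Y" shows "card (orbit y) = period y"
proof -
  have "inj_on (\<lambda>k. act k y) {..<period y}"
  proof (rule linorder_inj_onI', rule notI)
    fix i j assume ij: "j \<in> {..<period y}" "i < j" and eq: "act i y = act j y"
    have "i + (j - i) = j" using ij by simp
    then have "act i (act (j - i) y) = act i y"
      using eq act_add[OF assms, of i "j - i"] by simp
    then have "act (j - i) y = y" by (rule act_inj[OF act_closed[OF assms] assms])
    then show False using ij act_eq_self_iff[OF assms] by (auto dest: dvd_imp_le)
  qed
  then show ?thesis by (simp add: orbit_eq_image_period[OF assms] card_image)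
qed

lemma mem_orbit_if_act_mem_orbit:
  assumes "z \<in> Y" "y \<in> Y" "act k z \<in> orbit y" shows "z \<in> orbit y"
proof -
  obtain j where j: "act k z = act j y" using assms(3) unfolding orbit_def by blast
  have "z = act (n * k - k) (act k z)" using act_inverse[OF assms(1)] by simp
  also have "\<dots> = act (n * k - k + j) y" using j act_add[OF assms(2)] by simp
  finally show ?thesis unfolding orbit_def by blast
qed

lemma act_eq_self_iff_orbit:
  assumes "y \<in> Y" "z \<in> orbit y" shows "act k z = z \<longleftrightarrow> act k y = y"
proof -
  obtain i where z: "z = act i y" using assms(2) unfolding orbit_def by blast
  have "act k z = act i (act k y)" using z act_commute[OF assms(1)] by simp
  then have "act k z = z \<longleftrightarrow> act i (act k y) = act i y" using z by simp
  also have "\<dots> \<longleftrightarrow> act k y = y" by (auto dest: act_inj[OF act_closed[OF assms(1)] assms(1)])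
  finally show ?thesis .
qed

lemma sum_prime_power_factors_le_card_orbit:
  assumes "y \<in> Y" "P \<subseteq> prime_factors n" "\<And>p. p \<in> P \<Longrightarrow> act (n div p) y \<noteq> y"
  shows "(\<Sum>p\<in>P. p ^ multiplicity p n) \<le> card (orbit y)"
  unfolding card_orbit[OF assms(1)]
proof (rule sum_prime_power_factors_le[OF assms(2)])
  show "0 < period y" using period_pos_fixes[OF assms(1)] by simp
  show "p ^ multiplicity p n dvd period y" if "p \<in> P" for p
  proof (rule prime_power_factor_dvd_if_not_dvd_div)
    show "period y dvd n" using act_mult_order[OF assms(1), of 1] act_eq_self_iff[OF assms(1)] by simp
    show "p \<in> prime_factors n" using that assms(2) by blast
    show "\<not> period y dvd n div p" using that assms(3) act_eq_self_iff[OF assms(1)] by blast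
  qed
qed

lemma sum_prime_power_factors_le_card:
  assumes "finite Z" "Z \<subseteq> Y" "\<And>z k. z \<in> Z \<Longrightarrow> act k z \<in> Z" "P \<subseteq> prime_factors n"
    "\<And>p. p \<in> P \<Longrightarrow> \<exists>z\<in>Z. act (n div p) z \<noteq> z"
  shows "(\<Sum>p\<in>P. p ^ multiplicity p n) \<le> card Z"
  using assms
proof (induction "card Z" arbitrary: Z P rule: less_induct)
  case less
  show ?case
  proof (cases "P = {}")
    case False
    then obtain y where y: "y \<in> Z" "\<exists>p\<in>P. act (n div p) y \<noteq> y" using less.prems(5) by blast
    have "y \<in> Y" using less.prems(2) y by blast
    define C where "C = orbit y"
    define P1 where "P1 = {p \<in> P. act (n div p) y \<noteq> y}"
    have "C \<subseteq> Z" unfolding C_def orbit_def using less.prems(3) y(1) by blast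
    have "(\<Sum>p\<in>P - P1. p ^ multiplicity p n) \<le> card (Z - C)"
    proof (rule less.hyps)
      show "card (Z - C) < card Z"
        using less.prems(1) y(1) self_in_orbit[OF \<open>y \<in> Y\<close>] by (intro psubset_card_mono) (auto simp: C_def)
      show "act k z \<in> Z - C" if "z \<in> Z - C" for z k
        using that less.prems(2,3) mem_orbit_if_act_mem_orbit[OF _ \<open>y \<in> Y\<close>] unfolding C_def by blast
      show "\<exists>z\<in>Z - C. act (n div p) z \<noteq> z" if "p \<in> P - P1" for p
        using that less.prems(5) act_eq_self_iff_orbit[OF \<open>y \<in> Y\<close>] unfolding C_def P1_def by blast
    qed (use less.prems in auto)
    moreover have "(\<Sum>p\<in>P1. p ^ multiplicity p n) \<le> card C"
      unfolding C_def P1_def using less.prems(4) \<open>y \<in> Y\<close>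
      by (intro sum_prime_power_factors_le_card_orbit) auto
    moreover have "finite P" using less.prems(4) finite_subset by blast
    moreover have "card Z = card C + card (Z - C)"
      using \<open>C \<subseteq> Z\<close> less.prems(1) by (metis card_Diff_subset card_mono finite_subset le_add_diff_inverse)
    moreover have "(\<Sum>p\<in>P. p ^ multiplicity p n) =
        (\<Sum>p\<in>P - P1. p ^ multiplicity p n) + (\<Sum>p\<in>P1. p ^ multiplicity p n)"
      using \<open>finite P\<close> by (intro sum.subset_diff) (auto simp: P1_def)
    ultimately show ?thesis by linarith
  qed simp
qed

lemma prime_power_sum_le_card:
  assumes "finite Y" shows "prime_power_sum n \<le> card Y"
  unfolding prime_power_sum_def
proof (rule sum_prime_power_factors_le_card[OF assms order_refl act_closed order_refl])
  fix p assume "p \<in> prime_factors n"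
  then have p: "prime p" "p dvd n" by (auto simp: in_prime_factors_iff)
  then have "0 < n div p" using order_pos by (metis dvd_mult_div_cancel mult_0_right neq0_conv)
  moreover have "n div p < n" using order_pos prime_gt_1_nat[OF p(1)] by (rule div_less_dividend[rotated])
  ultimately have "\<not> n dvd n div p" by (auto dest: dvd_imp_le)
  then show "\<exists>y\<in>Y. act (n div p) y \<noteq> y" using act_trivial_iff by blast
qed

end

section \<open>Lines of a vector space over a finite field\<close>

lemma finite_UNIV_vec: "finite (UNIV :: 'a set) \<Longrightarrow> finite (UNIV :: ('a ^ 'n) set)"
  by (metis CARD_vec card_ge_0_finite finite_UNIV_card_ge_0 zero_less_power)

definition line :: "'a::field ^ 'n \<Rightarrow> ('a ^ 'n) set" where
  "line v = {c *s v | c. c \<noteq> 0}"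

definition lines :: "('a::field ^ 'n) set set" where
  "lines = {line v | v. v \<noteq> 0}"

definition line_rep :: "('a::field ^ 'n) set \<Rightarrow> 'a ^ 'n" where
  "line_rep l = (SOME v. v \<in> l)"

definition line_coord :: "'a::field ^ 'n \<Rightarrow> 'a" where
  "line_coord v = (SOME c. c \<noteq> 0 \<and> v = c *s line_rep (line v))"

lemma self_in_line: "v \<noteq> 0 \<Longrightarrow> v \<in> line v"
  unfolding line_def by (auto intro: exI[of _ 1])

lemma zero_notin_line: "(v::'a::field ^ 'n) \<noteq> 0 \<Longrightarrow> 0 \<notin> line v"
  unfolding line_def by auto

lemma line_smult:
  assumes "c \<noteq> 0" shows "line (c *s v) = line (v::'a::field ^ 'n)"
proof
  show "line (c *s v) \<subseteq> line v" unfolding line_def using assms by auto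
  show "line v \<subseteq> line (c *s v)"
  proof
    fix x assume "x \<in> line v"
    then obtain d where "d \<noteq> 0" "x = d *s v" unfolding line_def by blast
    then have "x = (d / c) *s (c *s v)" "d / c \<noteq> 0" using assms by simp_all
    then show "x \<in> line (c *s v)" unfolding line_def by blast
  qed
qed

lemma line_eq_if_mem:
  assumes "w \<in> line v" shows "line w = line (v::'a::field ^ 'n)"
proof -
  obtain c where "c \<noteq> 0" "w = c *s v" using assms unfolding line_def by blast
  then show ?thesis by (simp add: line_smult)
qed

lemma line_in_lines: "v \<noteq> 0 \<Longrightarrow> line v \<in> lines"
  unfolding lines_def by auto

lemma line_rep:
  assumes "l \<in> (lines :: ('a::field ^ 'n) set set)"
  shows "line_rep l \<in> l" "line_rep l \<noteq> 0" "line (line_rep l) = l"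
proof -
  obtain v where v: "v \<noteq> 0" "l = line v" using assms unfolding lines_def by auto
  then have "v \<in> l" using self_in_line by simp
  then show rep: "line_rep l \<in> l" unfolding line_rep_def by (rule someI)
  then show "line_rep l \<noteq> 0" using v zero_notin_line[OF v(1)] by auto
  show "line (line_rep l) = l" using line_eq_if_mem[of "line_rep l" v] rep v(2) by simp
qed

lemma line_coord:
  assumes "(v::'a::field ^ 'n) \<noteq> 0"
  shows "line_coord v \<noteq> 0" "v = line_coord v *s line_rep (line v)"
proof -
  obtain c where "c \<noteq> 0" "line_rep (line v) = c *s v"
    using line_rep(1)[OF line_in_lines[OF assms]] unfolding line_def by blast
  then have "\<exists>c. c \<noteq> 0 \<and> v = c *s line_rep (line v)"
    by (intro exI[of _ "inverse c"]) simp
  then have "line_coord v \<noteq> 0 \<and> v = line_coord v *s line_rep (line v)"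
    unfolding line_coord_def by (rule someI_ex)
  then show "line_coord v \<noteq> 0" "v = line_coord v *s line_rep (line v)" by auto
qed

lemma line_coord_unique:
  assumes "(v::'a::field ^ 'n) \<noteq> 0" "v = c *s line_rep (line v)"
  shows "line_coord v = c"
proof -
  have "line_coord v *s line_rep (line v) = c *s line_rep (line v)"
    using line_coord(2)[OF assms(1)] assms(2) by metis
  then show ?thesis using line_rep(2)[OF line_in_lines[OF assms(1)]] by simp
qed

lemma line_coord_smult:
  assumes "(v::'a::field ^ 'n) \<noteq> 0" "c \<noteq> 0"
  shows "line_coord (c *s v) = c * line_coord v"
proof (rule line_coord_unique)
  show "c *s v \<noteq> 0" using assms by simp
  show "c *s v = (c * line_coord v) *s line_rep (line (c *s v))"
    using line_coord(2)[OF assms(1)] line_smult[OF assms(2)] by (metis vector_smult_assoc)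
qed

lemma card_line:
  assumes "finite (UNIV :: 'a set)" "(v::'a::field ^ 'n) \<noteq> 0"
  shows "card (line v) = CARD('a) - 1"
proof -
  have "line v = (\<lambda>c. c *s v) ` (UNIV - {0})" unfolding line_def by auto
  moreover have "inj_on (\<lambda>c. c *s v) (UNIV - {0})" using assms(2) by (auto simp: inj_on_def)
  ultimately show ?thesis using assms(1) by (simp add: card_image card_Diff_singleton)
qed

lemma finite_lines: "finite (UNIV :: 'a set) \<Longrightarrow> finite (lines :: ('a::field ^ 'n) set set)"
  using finite_UNIV_vec by (metis Pow_UNIV finite_Pow_iff finite_subset top_greatest)

lemma card_lines:
  assumes fin: "finite (UNIV :: 'a::field set)"
  shows "card (lines :: ('a ^ 'n) set set) = (CARD('a) ^ CARD('n) - 1) div (CARD('a) - 1)"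
proof -
  have "(CARD('a) - 1) * card (lines :: ('a ^ 'n) set set) = card (\<Union>(lines :: ('a ^ 'n) set set))"
  proof (rule card_partition[OF finite_lines[OF fin]])
    show "finite (\<Union>(lines :: ('a ^ 'n) set set))"
      using finite_UNIV_vec[OF fin] by (rule finite_subset[rotated]) simp
    show "card l = CARD('a) - 1" if "l \<in> (lines :: ('a ^ 'n) set set)" for l
      using that card_line[OF fin] unfolding lines_def by auto
    show "l1 \<inter> l2 = {}" if "l1 \<in> lines" "l2 \<in> lines" "l1 \<noteq> l2" for l1 l2 :: "('a ^ 'n) set"
      using that line_eq_if_mem unfolding lines_def by blast
  qed
  also have "\<Union>(lines :: ('a ^ 'n) set set) = UNIV - {0}"
    unfolding lines_def using self_in_line zero_notin_line by blast
  also have "card (UNIV - {0 :: 'a ^ 'n}) = CARD('a) ^ CARD('n) - 1"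
    using fin by (simp add: card_Diff_singleton finite_UNIV_vec)
  finally have "(CARD('a) - 1) * card (lines :: ('a ^ 'n) set set) = CARD('a) ^ CARD('n) - 1" .
  moreover have "CARD('a) - 1 \<noteq> 0" using two_le_card_field[OF fin] by simp
  ultimately show ?thesis by (metis nonzero_mult_div_cancel_left)
qed

lemma matrix_eq_if_line_reps:
  fixes A B :: "'a::field ^ 'm ^ 'n"
  assumes "\<And>l. l \<in> lines \<Longrightarrow> line_rep l v* A = line_rep l v* B"
  shows "A = B"
proof -
  have "x v* A = x v* B" for x
  proof (cases "x = 0")
    case False
    then have "x = line_coord x *s line_rep (line x)" by (rule line_coord(2))
    then show ?thesis using assms[OF line_in_lines[OF False]] by (metis scalar_vector_matrix_assoc)
  qed simp
  then show ?thesis by (metis matrix_eq transpose_matrix_vector transpose_transpose)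
qed

section \<open>Faithful actions by partial maps\<close>

lemma min_pt_degree_eqI:
  "faithful_pt_action S op d \<Longrightarrow> (\<And>m. faithful_pt_action S op m \<Longrightarrow> d \<le> m) \<Longrightarrow>
    min_pt_degree S op = d"
  unfolding min_pt_degree_def by (rule Least_equality)

definition relabel ::
    "('x \<Rightarrow> nat) \<Rightarrow> 'x set \<Rightarrow> ('x \<Rightarrow> 'x option) \<Rightarrow> nat \<Rightarrow> nat option" where
  "relabel h X f n = (if n \<in> h ` X then map_option h (f (inv_into X h n)) else None)"

lemma relabel_image:
  "inj_on h X \<Longrightarrow> x \<in> X \<Longrightarrow> relabel h X f (h x) = map_option h (f x)"
  by (simp add: relabel_def)

lemma relabel_in_partial_maps:
  assumes "ran f \<subseteq> X" shows "dom (relabel h X f) \<subseteq> h ` X" "ran (relabel h X f) \<subseteq> h ` X"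
  using assms by (auto simp: relabel_def dom_def ran_def split: if_splits)

lemma relabel_map_comp:
  assumes "inj_on h X" "ran f \<subseteq> X"
  shows "relabel h X (g \<circ>\<^sub>m f) = relabel h X g \<circ>\<^sub>m relabel h X f"
proof
  fix n show "relabel h X (g \<circ>\<^sub>m f) n = (relabel h X g \<circ>\<^sub>m relabel h X f) n"
  proof (cases "n \<in> h ` X")
    case True
    then obtain x where x: "x \<in> X" "n = h x" by blast
    show ?thesis
    proof (cases "f x")
      case (Some y)
      then have "y \<in> X" using assms(2) by (auto simp: ran_def)
      then show ?thesis using x Some assms(1) by (simp add: relabel_image map_comp_def)
    qed (use x assms(1) in \<open>simp add: relabel_image map_comp_def\<close>)
  qed (simp add: relabel_def map_comp_def)
qed

lemma relabel_inj:
  assumes "inj_on h X" "dom f \<subseteq> X" "ran f \<subseteq> X" "dom g \<subseteq> X" "ran g \<subseteq> X"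
    and "relabel h X f = relabel h X g"
  shows "f = g"
proof
  fix x show "f x = g x"
  proof (cases "x \<in> X")
    case True
    then have "map_option h (f x) = map_option h (g x)"
      using assms(1,6) relabel_image by metis
    then show ?thesis
    proof (rule option.inj_map_strong[rotated])
      fix a b assume "a \<in> set_option (f x)" "b \<in> set_option (g x)" "h a = h b"
      moreover have "a \<in> X" "b \<in> X" using calculation(1,2) assms(3,5) by (auto intro: ranI)
      ultimately show "a = b" using assms(1) by (auto dest: inj_onD)
    qed
  next
    case False
    then have "f x = None" "g x = None" using assms(2,4) by auto
    then show ?thesis by simp
  qed
qed

lemma faithful_pt_action_of_finite_set:
  fixes \<psi> :: "'s \<Rightarrow> 'x \<Rightarrow> 'x option"
  assumes "finite X" and "inj_on \<psi> S"
    and "\<And>s. s \<in> S \<Longrightarrow> dom (\<psi> s) \<subseteq> X \<and> ran (\<psi> s) \<subseteq> X"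
    and "\<And>s t. s \<in> S \<Longrightarrow> t \<in> S \<Longrightarrow> \<psi> (op s t) = \<psi> t \<circ>\<^sub>m \<psi> s"
  shows "faithful_pt_action S op (card X)"
proof -
  obtain h where h: "bij_betw h X {0..<card X}" using ex_bij_betw_finite_nat[OF assms(1)] by blast
  then have inj: "inj_on h X" and img: "h ` X = {..<card X}" by (auto simp: bij_betw_def)
  show ?thesis unfolding faithful_pt_action_def
  proof (intro exI[of _ "\<lambda>s. relabel h X (\<psi> s)"] conjI ballI)
    show "inj_on (\<lambda>s. relabel h X (\<psi> s)) S"
      using assms(2,3) relabel_inj[OF inj] by (auto simp: inj_on_def)
    show "relabel h X (\<psi> s) \<in> partial_maps_on (card X)" if "s \<in> S" for s
      using relabel_in_partial_maps[of "\<psi> s" X h] assms(3)[OF that] img by (simp add: partial_maps_on_def)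
    show "relabel h X (\<psi> (op s t)) = relabel h X (\<psi> t) \<circ>\<^sub>m relabel h X (\<psi> s)" if "s \<in> S" "t \<in> S" for s t
      using assms(3,4) that relabel_map_comp[OF inj] by simp
  qed
qed

section \<open>Upper bound\<close>

locale lines_times_cycles =
  fixes P :: "'i set" and w :: "'i \<Rightarrow> nat" and ind :: "'a::field \<Rightarrow> nat"
  assumes finite_field: "finite (UNIV :: 'a set)"
    and finite_P: "finite P" and P_nonempty: "P \<noteq> {}" and w_pos: "p \<in> P \<Longrightarrow> 0 < w p"
    and ind_mult: "p \<in> P \<Longrightarrow> c \<noteq> 0 \<Longrightarrow> d \<noteq> 0 \<Longrightarrow> [ind (c * d) = ind c + ind d] (mod w p)"
    and ind_inj:
      "c \<noteq> 0 \<Longrightarrow> d \<noteq> 0 \<Longrightarrow> (\<And>p. p \<in> P \<Longrightarrow> [ind c = ind d] (mod w p)) \<Longrightarrow> c = d"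
begin

definition points :: "(('a ^ 'n) set \<times> 'i \<times> nat) set" where
  "points = lines \<times> Sigma P (\<lambda>p. {..<w p})"

definition point :: "'i \<Rightarrow> nat \<Rightarrow> 'a ^ 'n \<Rightarrow> ('a ^ 'n) set \<times> 'i \<times> nat" where
  "point p j v = (line v, p, (j + ind (line_coord v)) mod w p)"

text \<open>The point \<open>(l, p, j)\<close> stands for the class of the vectors \<open>c *s line_rep l\<close>
  with \<open>[ind c = j] (mod w p)\<close>; accordingly \<open>point p j v\<close> is the class of \<open>c *s v\<close>
  for any such \<open>c\<close>.\<close>

definition act ::
    "'a ^ 'n ^ 'n \<Rightarrow> ('a ^ 'n) set \<times> 'i \<times> nat \<Rightarrow> (('a ^ 'n) set \<times> 'i \<times> nat) option" where
  "act A = (\<lambda>(l, p, j). if (l, p, j) \<in> points \<and> line_rep l v* A \<noteq> 0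
     then Some (point p j (line_rep l v* A)) else None)"

lemma card_points:
  "card (points :: (('a ^ 'n) set \<times> 'i \<times> nat) set) = card (lines :: ('a ^ 'n) set set) * (\<Sum>p\<in>P. w p)"
  unfolding points_def using finite_lines[OF finite_field] finite_P by (simp add: card_cartesian_product)

lemma point_in_points: "p \<in> P \<Longrightarrow> v \<noteq> 0 \<Longrightarrow> point p j v \<in> points"
  unfolding points_def point_def using w_pos by (simp add: line_in_lines)

lemma point_smult:
  assumes "p \<in> P" "c \<noteq> 0" "v \<noteq> 0"
  shows "point p j (c *s v) = point p ((j + ind c) mod w p) v"
proof -
  have "[ind (c * line_coord v) = ind c + ind (line_coord v)] (mod w p)"
    using ind_mult assms line_coord(1) by blast
  then have "(j + ind (c * line_coord v)) mod w p = ((j + ind c) mod w p + ind (line_coord v)) mod w p"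
    unfolding cong_def by (metis add.assoc mod_add_left_eq mod_add_right_eq)
  then show ?thesis unfolding point_def using assms by (simp add: line_smult line_coord_smult)
qed

lemma point_inj:
  assumes "u \<noteq> 0" "v \<noteq> 0" "\<And>p. p \<in> P \<Longrightarrow> point p 0 u = point p 0 v"
  shows "u = v"
proof -
  obtain p0 where "p0 \<in> P" using P_nonempty by blast
  then have "line u = line v" using assms(3) by (simp add: point_def)
  moreover have "line_coord u = line_coord v"
    using assms line_coord(1) by (intro ind_inj) (auto simp: point_def cong_def)
  ultimately show ?thesis using line_coord(2) assms(1,2) by metis
qed

lemma act_mult:
  fixes A B :: "'a ^ 'n ^ 'n"
  shows "act (A ** B) = act B \<circ>\<^sub>m act A"
proof
  fix x :: "('a ^ 'n) set \<times> 'i \<times> nat"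
  obtain l p j where x: "x = (l, p, j)" by (cases x) auto
  show "act (A ** B) x = (act B \<circ>\<^sub>m act A) x"
  proof (cases "x \<in> points \<and> line_rep l v* A \<noteq> 0")
    case True
    define v where "v = line_rep l v* A"
    define u where "u = line_rep (line v) v* B"
    have "p \<in> P" "v \<noteq> 0" using True x by (auto simp: points_def v_def)
    have AB: "line_rep l v* (A ** B) = line_coord v *s u"
      unfolding u_def v_def vector_matrix_mul_assoc[symmetric]
      by (metis line_coord(2) scalar_vector_matrix_assoc True v_def)
    have "act A x = Some (line v, p, (j + ind (line_coord v)) mod w p)"
      using True unfolding x act_def v_def point_def by simp
    moreover have "line_coord v *s u = 0 \<longleftrightarrow> u = 0" using line_coord(1)[OF \<open>v \<noteq> 0\<close>] by simp
    moreover have "(line v, p, (j + ind (line_coord v)) mod w p) \<in> points"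
      using point_in_points[OF \<open>p \<in> P\<close> \<open>v \<noteq> 0\<close>] by (simp add: point_def)
    ultimately show ?thesis
      using True \<open>p \<in> P\<close> \<open>v \<noteq> 0\<close> line_coord(1)[OF \<open>v \<noteq> 0\<close>]
      by (auto simp: x act_def AB u_def[symmetric] point_smult map_comp_def)
  next
    case False
    then show ?thesis
      by (auto simp: x act_def map_comp_def vector_matrix_mul_assoc[symmetric])
  qed
qed

lemma act_dom_ran: "dom (act A) \<subseteq> points" "ran (act A) \<subseteq> points"
proof -
  show "dom (act A) \<subseteq> points" by (auto simp: act_def dom_def split: if_splits)
  show "ran (act A) \<subseteq> points"
  proof
    fix y assume "y \<in> ran (act A)"
    then obtain l p j where "(l, p, j) \<in> points" "line_rep l v* A \<noteq> 0" "y = point p j (line_rep l v* A)"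
      by (auto simp: ran_def act_def split: if_splits)
    then show "y \<in> points" using point_in_points by (auto simp: points_def)
  qed
qed

lemma act_inj: "inj act"
proof (rule injI)
  fix A B :: "'a ^ 'n ^ 'n" assume eq: "act A = act B"
  show "A = B"
  proof (rule matrix_eq_if_line_reps)
    fix l :: "('a ^ 'n) set" assume l: "l \<in> lines"
    have "(l, p, 0) \<in> points" if "p \<in> P" for p using l that w_pos by (simp add: points_def)
    then have same: "act A (l, p, 0) = act B (l, p, 0)" for p using eq by simp
    show "line_rep l v* A = line_rep l v* B"
    proof (cases "line_rep l v* A = 0 \<or> line_rep l v* B = 0")
      case True
      obtain p0 where "p0 \<in> P" using P_nonempty by blast
      then show ?thesis using True same[of p0] \<open>\<And>p. p \<in> P \<Longrightarrow> (l, p, 0) \<in> points\<close>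
        by (auto simp: act_def split: if_splits)
    next
      case False
      moreover have "point p 0 (line_rep l v* A) = point p 0 (line_rep l v* B)" if "p \<in> P" for p
        using same[of p] \<open>\<And>p. p \<in> P \<Longrightarrow> (l, p, 0) \<in> points\<close>[OF that] False by (simp add: act_def)
      ultimately show ?thesis by (intro point_inj) auto
    qed
  qed
qed

lemma faithful_pt_action_points:
  "faithful_pt_action (UNIV :: ('a ^ 'n ^ 'n) set) (**) (card (lines :: ('a ^ 'n) set set) * (\<Sum>p\<in>P. w p))"
  unfolding card_points[symmetric]
proof (rule faithful_pt_action_of_finite_set)
  show "finite (points :: (('a ^ 'n) set \<times> 'i \<times> nat) set)"
    unfolding points_def using finite_lines[OF finite_field] finite_P
    by (intro finite_cartesian_product finite_SigmaI) auto
  show "dom (act A) \<subseteq> points \<and> ran (act A) \<subseteq> points" for A :: "'a ^ 'n ^ 'n"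
    using act_dom_ran by blast
qed (use act_inj act_mult in auto)

end

lemma faithful_pt_action_matrices_moduli:
  fixes g :: "'a::field" and P :: "'i set" and w :: "'i \<Rightarrow> nat"
  assumes "finite (UNIV :: 'a set)"
    and gen: "\<And>x. x \<noteq> 0 \<Longrightarrow> \<exists>i. g ^ i = x"
    and pow_eq: "\<And>i j. g ^ i = g ^ j \<longleftrightarrow> [i = j] (mod CARD('a) - 1)"
    and "finite P" "P \<noteq> {}" and w: "\<And>p. p \<in> P \<Longrightarrow> 0 < w p \<and> w p dvd CARD('a) - 1"
    and crt: "\<And>a b. (\<And>p. p \<in> P \<Longrightarrow> [a = b] (mod w p)) \<Longrightarrow> [a = b] (mod CARD('a) - 1)"
  shows "faithful_pt_action (UNIV :: ('a ^ 'n ^ 'n) set) (**)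
           (card (lines :: ('a ^ 'n) set set) * (\<Sum>p\<in>P. w p))"
proof -
  have dlog: "g ^ dlog g x = x" if "x \<noteq> 0" for x using gen[OF that] by (rule power_dlog)
  interpret lines_times_cycles P w "dlog g"
  proof
    fix p and c d :: 'a assume "p \<in> P" "c \<noteq> 0" "d \<noteq> 0"
    then have "g ^ dlog g (c * d) = g ^ (dlog g c + dlog g d)" by (simp add: dlog power_add)
    then show "[dlog g (c * d) = dlog g c + dlog g d] (mod w p)"
      using pow_eq w[OF \<open>p \<in> P\<close>] cong_dvd_modulus_nat by blast
  next
    fix c d :: 'a assume "c \<noteq> 0" "d \<noteq> 0" "\<And>p. p \<in> P \<Longrightarrow> [dlog g c = dlog g d] (mod w p)"
    then show "c = d" using crt pow_eq dlog by metis
  qed (use assms w in auto)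
  show ?thesis by (rule faithful_pt_action_points)
qed

lemma faithful_pt_action_matrices:
  assumes fin: "finite (UNIV :: 'a::field set)"
  shows "faithful_pt_action (UNIV :: ('a ^ 'n ^ 'n) set) (**)
           (card (lines :: ('a ^ 'n) set set) * max 1 (prime_power_sum (CARD('a) - 1)))"
proof -
  obtain g :: 'a where gen: "\<And>x. x \<noteq> 0 \<Longrightarrow> \<exists>i. g ^ i = x"
    and pow_eq: "\<And>i j. g ^ i = g ^ j \<longleftrightarrow> [i = j] (mod CARD('a) - 1)"
    using finite_field_generator[OF fin] by metis
  show ?thesis
  proof (cases "CARD('a) - 1 = 1")
    case True
    have "faithful_pt_action (UNIV :: ('a ^ 'n ^ 'n) set) (**)
      (card (lines :: ('a ^ 'n) set set) * (\<Sum>p\<in>{1::nat}. 1))"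
    proof (rule faithful_pt_action_matrices_moduli[OF fin gen pow_eq])
      show "[a = b] (mod CARD('a) - 1)" for a b using True by simp
    qed auto
    moreover have "max 1 (prime_power_sum (CARD('a) - 1)) = 1"
      using True by (simp add: prime_power_sum_def)
    ultimately show ?thesis by simp
  next
    case False
    let ?N = "CARD('a) - 1"
    have "1 < ?N" using False two_le_card_field[OF fin] by simp
    then have "max 1 (prime_power_sum ?N) = (\<Sum>p\<in>prime_factors ?N. p ^ multiplicity p ?N)"
      using prime_power_sum_ge_2[of ?N] by (simp add: prime_power_sum_def)
    moreover have "faithful_pt_action (UNIV :: ('a ^ 'n ^ 'n) set) (**)
      (card (lines :: ('a ^ 'n) set set) * (\<Sum>p\<in>prime_factors ?N. p ^ multiplicity p ?N))"
    proof (rule faithful_pt_action_matrices_moduli[OF fin gen pow_eq,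
        of "prime_factors ?N" "\<lambda>p. p ^ multiplicity p ?N"])
      show "prime_factors ?N \<noteq> {}"
        using prime_power_sum_ge_2[OF \<open>1 < ?N\<close>] by (auto simp: prime_power_sum_def)
      show "0 < p ^ multiplicity p ?N \<and> p ^ multiplicity p ?N dvd ?N" if "p \<in> prime_factors ?N" for p
        using that multiplicity_dvd[of p ?N] prime_gt_0_nat[of p] by (simp add: in_prime_factors_iff)
      show "[a = b] (mod ?N)" if "\<And>p. p \<in> prime_factors ?N \<Longrightarrow> [a = b] (mod p ^ multiplicity p ?N)" for a b
        using \<open>1 < ?N\<close> by (intro cong_if_cong_prime_power_factors[OF _ that]) simp
    qed auto
    ultimately show ?thesis by simp
  qed
qed

section \<open>Lower bound\<close>

definition dot :: "'a::field ^ 'n \<Rightarrow> 'a ^ 'n \<Rightarrow> 'a" where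
  "dot w u = (\<Sum>k\<in>UNIV. w $ k * u $ k)"

definition outer :: "'a::field ^ 'n \<Rightarrow> 'a ^ 'm \<Rightarrow> 'a ^ 'm ^ 'n" where
  "outer u w = (\<chi> i j. u $ i * w $ j)"

lemma outer_mult: "outer u w ** outer u' w' = outer (dot w u' *s u) w'"
proof -
  have "(\<Sum>k\<in>UNIV. u $ i * w $ k * (u' $ k * w' $ j)) = dot w u' * u $ i * w' $ j" for i j
    unfolding dot_def by (simp add: sum_distrib_left sum_distrib_right mult_ac)
  then show ?thesis by (simp add: matrix_matrix_mult_def outer_def vec_eq_iff)
qed

lemma outer_zero: "outer 0 w = 0"
  by (simp add: outer_def vec_eq_iff)

lemma dot_smult: "dot w (c *s u) = c * dot w u"
  by (simp add: dot_def sum_distrib_left mult_ac)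

lemma dot_axis: "dot w (axis j a) = w $ j * a"
  by (simp add: dot_def axis_def if_distrib[of "\<lambda>x. _ * x"] cong: if_cong)

lemma dot_add: "dot w (u + v) = dot w u + dot w v"
  by (simp add: dot_def distrib_left sum.distrib)

lemma outer_smult_mult:
  assumes "dot w u = 1" shows "outer (c *s u) w ** outer (d *s u) w = outer ((c * d) *s u) w"
  using assms by (simp add: outer_mult dot_smult mult.commute)

lemma outer_smult_eq_self_iff:
  assumes "dot w u = 1" shows "outer (c *s u) w = outer u w \<longleftrightarrow> c = 1"
proof
  assume eq: "outer (c *s u) w = outer u w"
  have "\<exists>k. w $ k * u $ k \<noteq> 0"
  proof (rule ccontr)
    assume "\<not> (\<exists>k. w $ k * u $ k \<noteq> 0)"
    then have "dot w u = 0" by (auto simp: dot_def intro!: sum.neutral)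
    with assms show False by simp
  qed
  then obtain k where "w $ k * u $ k \<noteq> 0" ..
  moreover have "c * (u $ k * w $ k) = u $ k * w $ k"
    using eq by (auto simp: outer_def vec_eq_iff mult.assoc)
  ultimately show "c = 1" by (simp add: mult.commute)
qed simp

lemma exists_dot_eq_1:
  assumes "(w::'a::field ^ 'n) \<noteq> 0" shows "\<exists>u. dot w u = 1"
proof -
  obtain k where "w $ k \<noteq> 0" using assms by (auto simp: vec_eq_iff)
  then show ?thesis by (intro exI[of _ "axis k (1 / w $ k)"]) (simp add: dot_axis)
qed

lemma exists_dot_separating:
  fixes w1 w2 :: "'a::field ^ 'n"
  assumes "w1 \<noteq> 0" and not_mult: "\<And>c. w2 \<noteq> c *s w1"
  shows "\<exists>u. dot w1 u = 0 \<and> dot w2 u = 1"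
proof -
  obtain k where k: "w1 $ k \<noteq> 0" using assms(1) by (auto simp: vec_eq_iff)
  define z where "z = w2 - (w2 $ k / w1 $ k) *s w1"
  have "z \<noteq> 0" using not_mult unfolding z_def by auto
  then obtain j where j: "z $ j \<noteq> 0" by (auto simp: vec_eq_iff)
  define a where "a = 1 / z $ j"
  define b where "b = - w1 $ j * a / w1 $ k"
  have "dot w1 (axis j a + axis k b) = w1 $ j * a + w1 $ k * b" by (simp add: dot_add dot_axis)
  also have "\<dots> = 0" unfolding b_def using k by simp
  finally have "dot w1 (axis j a + axis k b) = 0" .
  moreover have "dot w2 (axis j a + axis k b) = 1"
  proof -
    have "dot w2 (axis j a + axis k b) = w2 $ j * a + w2 $ k * b" by (simp add: dot_add dot_axis)
    also have "\<dots> = a * (w2 $ j - w2 $ k * w1 $ j / w1 $ k)" unfolding b_def by (simp add: algebra_simps)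
    also have "w2 $ j - w2 $ k * w1 $ j / w1 $ k = z $ j" unfolding z_def by simp
    also have "a * z $ j = 1" unfolding a_def using j by simp
    finally show ?thesis .
  qed
  ultimately show ?thesis by blast
qed

locale faithful_pt_representation =
  fixes op :: "'s \<Rightarrow> 's \<Rightarrow> 's" and zero :: 's
    and \<phi> :: "'s \<Rightarrow> nat \<Rightarrow> nat option" and m :: nat
  assumes zero_left: "op zero s = zero"
    and faithful: "inj \<phi>"
    and partial_map: "\<phi> s \<in> partial_maps_on m"
    and hom: "\<phi> (op s t) = \<phi> t \<circ>\<^sub>m \<phi> s"
begin

definition fixed :: "'s \<Rightarrow> nat set" where
  "fixed s = {x. \<phi> s x = Some x}"

lemma apply_op: "\<phi> (op s t) x = (case \<phi> s x of None \<Rightarrow> None | Some y \<Rightarrow> \<phi> t y)"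
  by (simp add: hom map_comp_def)

lemma fixed_subset: "fixed s \<subseteq> {..<m}"
  using partial_map[of s] by (auto simp: fixed_def partial_maps_on_def dom_def)

lemma fixed_zero: "x \<in> fixed zero \<Longrightarrow> \<phi> s x = Some x"
  using apply_op[of zero s x] by (simp add: fixed_def zero_left)

lemma fixed_mono:
  assumes "op e f = e" shows "fixed e \<subseteq> fixed f"
proof
  fix x assume "x \<in> fixed e"
  then have "\<phi> e x = Some x" by (simp add: fixed_def)
  moreover have "\<phi> e x = (case \<phi> e x of None \<Rightarrow> None | Some y \<Rightarrow> \<phi> f y)"
    using apply_op[of e f x] assms by simp
  ultimately show "x \<in> fixed f" by (simp add: fixed_def)
qed

lemma fixed_inter: "op e f = zero \<Longrightarrow> fixed e \<inter> fixed f \<subseteq> fixed zero"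
  using apply_op[of e f] by (auto simp: fixed_def split: option.splits)

lemma eq_if_fixes_fixed:
  assumes "op e e = e" "op e b = b" and fixes_all: "\<And>y. y \<in> fixed e - fixed zero \<Longrightarrow> \<phi> b y = Some y"
  shows "b = e"
proof -
  have "\<phi> b x = \<phi> e x" for x
  proof (cases "\<phi> e x")
    case None
    then show ?thesis using apply_op[of e b x] assms(2) by simp
  next
    case (Some y)
    then have "y \<in> fixed e" using apply_op[of e e x] assms(1) by (simp add: fixed_def)
    then have "\<phi> b y = Some y" using fixes_all fixed_zero by blast
    then show ?thesis using apply_op[of e b x] assms(2) Some by simp
  qed
  then have "\<phi> b = \<phi> e" ..
  then show ?thesis using faithful by (simp add: inj_eq)
qed

lemma unit_maps_fixed:
  assumes "op b e = b" "op b b' = e" "x \<in> fixed e - fixed zero"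
  shows "\<exists>y \<in> fixed e - fixed zero. \<phi> b x = Some y"
proof -
  have "\<phi> (op b b') x = Some x" using assms(2,3) by (simp add: fixed_def)
  then obtain y where y: "\<phi> b x = Some y" "\<phi> b' y = Some x"
    by (auto simp: apply_op split: option.splits)
  have "y \<in> fixed e" using apply_op[of b e x] assms(1) y(1) by (simp add: fixed_def)
  moreover have "y \<notin> fixed zero" using fixed_zero[of y b'] y(2) assms(3) by auto
  ultimately show ?thesis using y(1) by blast
qed

end

locale matrix_pt_representation =
  faithful_pt_representation "(**)" "0 :: 'a::field ^ 'n ^ 'n" \<phi> m
  for \<phi> :: "'a::field ^ 'n ^ 'n \<Rightarrow> nat \<Rightarrow> nat option" and m :: nat +
  assumes finite_field: "finite (UNIV :: 'a set)"
begin

lemma rank_one_unit_maps_fixed: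
  assumes "dot w u = 1" "c \<noteq> 0" "y \<in> fixed (outer u w) - fixed 0"
  shows "\<exists>y' \<in> fixed (outer u w) - fixed 0. \<phi> (outer (c *s u) w) y = Some y'"
  using unit_maps_fixed[of "outer (c *s u) w" "outer u w" "outer (inverse c *s u) w" y]
    outer_smult_mult[OF assms(1), of c 1] outer_smult_mult[OF assms(1), of c "inverse c"] assms(2,3)
  by simp

lemma rank_one_eq_one_if_fixes:
  assumes "dot w u = 1" "\<And>y. y \<in> fixed (outer u w) - fixed 0 \<Longrightarrow> \<phi> (outer (c *s u) w) y = Some y"
  shows "c = 1"
proof -
  have "outer (c *s u) w = outer u w"
    using eq_if_fixes_fixed[of "outer u w" "outer (c *s u) w"] assms(2)
      outer_smult_mult[OF assms(1), of 1 1] outer_smult_mult[OF assms(1), of 1 c]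
    by simp
  then show ?thesis using outer_smult_eq_self_iff[OF assms(1)] by blast
qed

lemma rank_one_cyclic_action:
  fixes g :: 'a
  assumes "dot w u = 1" "g \<noteq> 0" and pow_eq: "\<And>i j. g ^ i = g ^ j \<longleftrightarrow> [i = j] (mod CARD('a) - 1)"
  shows "faithful_cyclic_action (fixed (outer u w) - fixed 0)
           (\<lambda>k y. the (\<phi> (outer ((g ^ k) *s u) w) y)) (CARD('a) - 1)"
proof -
  let ?Y = "fixed (outer u w) - fixed 0" and ?G = "\<lambda>k. outer ((g ^ k) *s u) w"
  have maps: "\<phi> (?G k) y = Some (the (\<phi> (?G k) y)) \<and> the (\<phi> (?G k) y) \<in> ?Y" if "y \<in> ?Y" for k y
    using rank_one_unit_maps_fixed[OF assms(1) _ that, of "g ^ k"] assms(2) by auto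
  show ?thesis
  proof
    show "0 < CARD('a) - 1" using two_le_card_field[OF finite_field] by simp
    show "the (\<phi> (?G k) y) \<in> ?Y" if "y \<in> ?Y" for k y using maps[OF that] by blast
    show "the (\<phi> (?G (i + j)) y) = the (\<phi> (?G i) (the (\<phi> (?G j) y)))" if y: "y \<in> ?Y" for i j y
    proof -
      have "?G (i + j) = ?G j ** ?G i"
        using outer_smult_mult[OF assms(1)] by (simp add: power_add mult.commute)
      moreover obtain y' where "\<phi> (?G j) y = Some y'" using maps[OF y] by blast
      ultimately show ?thesis by (simp add: apply_op)
    qed
    show "(\<forall>y\<in>?Y. the (\<phi> (?G k) y) = y) \<longleftrightarrow> CARD('a) - 1 dvd k" for k
    proof
      assume "\<forall>y\<in>?Y. the (\<phi> (?G k) y) = y"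
      then have "g ^ k = 1" using maps by (intro rank_one_eq_one_if_fixes[OF assms(1)]) metis
      then show "CARD('a) - 1 dvd k" using pow_eq[of k 0] by (simp add: cong_0_iff)
    next
      assume "CARD('a) - 1 dvd k"
      then have "g ^ k = 1" using pow_eq[of k 0] by (simp add: cong_0_iff)
      then show "\<forall>y\<in>?Y. the (\<phi> (?G k) y) = y" by (simp add: fixed_def)
    qed
  qed
qed

lemma card_fixed_rank_one:
  assumes "dot w u = 1"
  shows "max 1 (prime_power_sum (CARD('a) - 1)) \<le> card (fixed (outer u w) - fixed 0)"
proof -
  obtain g :: 'a where "g \<noteq> 0" and pow_eq: "\<And>i j. g ^ i = g ^ j \<longleftrightarrow> [i = j] (mod CARD('a) - 1)"
    using finite_field_generator[OF finite_field] by metis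
  interpret cyclic: faithful_cyclic_action "fixed (outer u w) - fixed 0"
      "\<lambda>k y. the (\<phi> (outer ((g ^ k) *s u) w) y)" "CARD('a) - 1"
    by (rule rank_one_cyclic_action[OF assms \<open>g \<noteq> 0\<close> pow_eq])
  have fin: "finite (fixed (outer u w) - fixed 0)" using fixed_subset finite_subset by blast
  have "fixed (outer u w) - fixed 0 \<noteq> {}"
  proof
    assume "fixed (outer u w) - fixed 0 = {}"
    then have "(0::'a) = 1" by (intro rank_one_eq_one_if_fixes[OF assms]) auto
    then show False by simp
  qed
  with fin have "0 < card (fixed (outer u w) - fixed 0)" by (simp add: card_gt_0_iff)
  then show ?thesis using cyclic.prime_power_sum_le_card[OF fin] by simp
qed

lemma fixed_rank_one_disjoint:
  assumes "dot w1 u1 = 1" "dot w2 u2 = 1" "line w1 \<noteq> line w2"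
  shows "(fixed (outer u1 w1) - fixed 0) \<inter> (fixed (outer u2 w2) - fixed 0) = {}"
proof -
  have "w1 \<noteq> 0" "w2 \<noteq> 0" using assms(1,2) by (auto simp: dot_def)
  have "w2 \<noteq> c *s w1" for c
    using assms(3) \<open>w2 \<noteq> 0\<close> line_smult[of c w1] by (cases "c = 0") auto
  then obtain u where u: "dot w1 u = 0" "dot w2 u = 1"
    using exists_dot_separating[OF \<open>w1 \<noteq> 0\<close>] by blast
  have "fixed (outer u1 w1) \<inter> fixed (outer u w2) \<subseteq> fixed 0"
    using u(1) by (intro fixed_inter) (simp add: outer_mult outer_zero)
  moreover have "fixed (outer u2 w2) \<subseteq> fixed (outer u w2)"
    using u(2) by (intro fixed_mono) (simp add: outer_mult)
  ultimately show ?thesis by blast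
qed

lemma card_lines_le_degree:
  "card (lines :: ('a ^ 'n) set set) * max 1 (prime_power_sum (CARD('a) - 1)) \<le> m"
proof -
  define u where "u l = (SOME u. dot (line_rep l) u = 1)" for l :: "('a ^ 'n) set"
  define Y where "Y l = fixed (outer (u l) (line_rep l)) - fixed 0" for l
  have u: "dot (line_rep l) (u l) = 1" if "l \<in> lines" for l
    unfolding u_def using exists_dot_eq_1[OF line_rep(2)[OF that]] by (rule someI_ex)
  have "card (lines :: ('a ^ 'n) set set) * max 1 (prime_power_sum (CARD('a) - 1)) \<le> (\<Sum>l\<in>lines. card (Y l))"
    using sum_bounded_below[of lines "max 1 (prime_power_sum (CARD('a) - 1))" "\<lambda>l. card (Y l)"]
      card_fixed_rank_one u unfolding Y_def by simp
  also have "\<dots> = card (\<Union>l\<in>lines. Y l)"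
  proof -
    have "finite (Y l)" for l unfolding Y_def using fixed_subset finite_subset by blast
    moreover have "Y l1 \<inter> Y l2 = {}" if "l1 \<in> lines" "l2 \<in> lines" "l1 \<noteq> l2" for l1 l2
      unfolding Y_def using that by (intro fixed_rank_one_disjoint u) (simp_all add: line_rep(3))
    ultimately have "card (\<Union>l\<in>lines. Y l) = (\<Sum>l\<in>lines. card (Y l))"
      using finite_lines[OF finite_field] by (intro card_UN_disjoint) auto
    then show ?thesis by simp
  qed
  also have "\<dots> \<le> card {..<m}"
    by (rule card_mono) (use fixed_subset in \<open>auto simp: Y_def\<close>)
  finally show ?thesis by simp
qed

end

lemma faithful_pt_action_matrices_degree_ge:
  assumes "finite (UNIV :: 'a::field set)" and "faithful_pt_action (UNIV :: ('a ^ 'n ^ 'n) set) (**) m"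
  shows "card (lines :: ('a ^ 'n) set set) * max 1 (prime_power_sum (CARD('a) - 1)) \<le> m"
proof -
  obtain \<phi> :: "'a ^ 'n ^ 'n \<Rightarrow> nat \<Rightarrow> nat option"
    where "inj \<phi>" "\<And>A. \<phi> A \<in> partial_maps_on m" "\<And>A B. \<phi> (A ** B) = \<phi> B \<circ>\<^sub>m \<phi> A"
    using assms(2) unfolding faithful_pt_action_def by blast
  then interpret matrix_pt_representation \<phi> m
    using assms(1) by unfold_locales (simp_all add: matrix_matrix_mult_def vec_eq_iff)
  show ?thesis by (rule card_lines_le_degree)
qed

theorem corollary2p14:
  fixes F :: "'a::field itself" and N :: "'n::finite itself"
  assumes "finite (UNIV :: 'a set)"
  shows "min_pt_degree (UNIV :: ('a ^ 'n ^ 'n) set) (**) =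
    (if CARD('a) = 2 then 2 ^ CARD('n) - 1
     else ((CARD('a) ^ CARD('n) - 1) div (CARD('a) - 1)) *
          (\<Sum>p\<in>prime_factors (CARD('a) - 1). p ^ multiplicity p (CARD('a) - 1)))"
proof -
  have "min_pt_degree (UNIV :: ('a ^ 'n ^ 'n) set) (**) =
      card (lines :: ('a ^ 'n) set set) * max 1 (prime_power_sum (CARD('a) - 1))"
    using faithful_pt_action_matrices[OF assms] faithful_pt_action_matrices_degree_ge[OF assms]
    by (rule min_pt_degree_eqI)
  also have "\<dots> = (if CARD('a) = 2 then 2 ^ CARD('n) - 1
     else ((CARD('a) ^ CARD('n) - 1) div (CARD('a) - 1)) *
          (\<Sum>p\<in>prime_factors (CARD('a) - 1). p ^ multiplicity p (CARD('a) - 1)))"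
  proof (cases "CARD('a) = 2")
    case False
    then have "2 \<le> prime_power_sum (CARD('a) - 1)"
      using two_le_card_field[OF assms] by (intro prime_power_sum_ge_2) simp
    then show ?thesis using False by (simp add: card_lines[OF assms] prime_power_sum_def)
  qed (simp add: card_lines[OF assms] prime_power_sum_def)
  finally show ?thesis .
qed

end
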